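(* For each positive integer $n$, let $F(n)$ be the minimum, over all families $\mathcal H$ of exactly $n$ affine hyperplanes in $\mathbb{R}^n$ that cover $\{0,1\}^n\setminus\{\mathbf 0\}$ and none of which contains the origin $\mathbf 0$, of $\max_{H\in\mathcal H}|H\cap\{0,1\}^n|$. Then, as $n\to\infty$, $$F(n)=(1+o(1))\frac{2^n}{n};\qquad\text{equivalently,}\qquad \lim_{n\to\infty}\frac{nF(n)}{2^n}=1.$$
   Context: An affine hyperplane in $\mathbb{R}^n$ is a set $\{x\in\mathbb{R}^n:\sum_{i=1}^n a_ix_i=b\}$ with $(a_1,\dots,a_n)\neq 0$. A family $\mathcal H$ covers a set $X$ if $X\subseteq\bigcup_{H\in\mathcal H}H$. *)

theory Defs
  imports Complex_Main "HOL-Library.FuncSet" "HOL-Library.Landau_Symbols"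
begin

text \<open>
  The dimension \<open>n\<close> varies, so n-dimensional real space is represented as the set of functions on
  \<open>{1..n}\<close>, extended by \<open>undefined\<close> outside that set. Each point therefore
  has exactly one representation, and cardinalities are the intended ones.
\<close>

definition real_space :: "nat \<Rightarrow> (nat \<Rightarrow> real) set" where
  "real_space n = {1..n} \<rightarrow>\<^sub>E UNIV"

definition origin :: "nat \<Rightarrow> nat \<Rightarrow> real" where
  "origin n = (\<lambda>i\<in>{1..n}. 0)"

definition cube :: "nat \<Rightarrow> (nat \<Rightarrow> real) set" where
  "cube n = {1..n} \<rightarrow>\<^sub>E {0, 1}"

definition affine_hyperplane :: "nat \<Rightarrow> (nat \<Rightarrow> real) set \<Rightarrow> bool" where
  "affine_hyperplane n h \<longleftrightarrow>
     (\<exists>a\<in>real_space n. \<exists>b. a \<noteq> origin n \<and>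
        h = {x \<in> real_space n. (\<Sum>i=1..n. a i * x i) = b})"

definition covers :: "'a set set \<Rightarrow> 'a set \<Rightarrow> bool" where
  "covers \<H> X \<longleftrightarrow> X \<subseteq> \<Union>\<H>"

definition cover_family :: "nat \<Rightarrow> (nat \<Rightarrow> real) set set \<Rightarrow> bool" where
  "cover_family n \<H> \<longleftrightarrow>
     finite \<H> \<and> card \<H> = n \<and>
     (\<forall>h\<in>\<H>. affine_hyperplane n h \<and> origin n \<notin> h) \<and>
     covers \<H> (cube n - {origin n})"

definition max_load :: "nat \<Rightarrow> (nat \<Rightarrow> real) set set \<Rightarrow> nat" where
  "max_load n \<H> = Max ((\<lambda>h. card (h \<inter> cube n)) ` \<H>)"

text \<open>
  For \<open>n \<ge> 1\<close> the hyperplanes \<open>x i = 1\<close> for \<open>i\<in>{1..n}\<close> form a cover family, so this is a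
  minimum over a nonempty set of natural numbers. The value at \<open>n = 0\<close> has no meaning.
\<close>

definition min_max_load :: "nat \<Rightarrow> nat" where
  "min_max_load n = (LEAST m. \<exists>\<H>. cover_family n \<H> \<and> m = max_load n \<H>)"

end

theory Submission
  imports Defs "HOL-Library.Nat_Bijection" "HOL-Real_Asymp.Real_Asymp"
begin

text \<open>
  The lower bound is counting. For the upper bound write \<open>n = m + k\<close> with \<open>m + 1 = 2 ^ k * d\<close>, and
  split a cube point into \<open>Y \<subseteq> {..<k}\<close>, read as a binary number, and \<open>X\<close> of size at most \<open>m\<close>. For
  \<open>t < 2 ^ k\<close> and \<open>r < d\<close> the condition \<open>|X| = d * (t XOR Y) + r\<close> is a hyperplane, since \<open>t XOR Y\<close> is
  affine in the bits of \<open>Y\<close> for fixed \<open>t\<close>. These \<open>m + 1\<close> hyperplanes partition the cube, and each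
  contains the sum over \<open>q\<close> of \<open>m choose (q * d + r)\<close> points, which is at most
  \<open>2 ^ m / d + 2 * (m choose (m div 2))\<close>. Only the one with \<open>t = r = 0\<close> contains the origin; it is
  replaced by the \<open>k\<close> hyperplanes \<open>|X| = d * Y + (m + 1) * (1 - y i)\<close>, each of which meets the cube in
  the points of the removed hyperplane with \<open>y i = 1\<close>. Every further dimension costs one hyperplane and
  exactly doubles the loads. Choosing \<open>2 ^ k\<close> of order \<open>n powr (3/4)\<close> makes the error terms vanish.
\<close>

section \<open>Hyperplanes and the cube\<close>

text \<open>
  A cube point is encoded by the set \<open>S \<subseteq> {..<n}\<close> of its coordinates equal to 1, shifted to start at 0;
  a pair \<open>(a, b)\<close> stands for the hyperplane with coefficients \<open>a\<close> and right-hand side \<open>b\<close>. Having at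
  most \<open>n\<close> hyperplanes suffices, since hyperplanes that miss the cube can be added.
\<close>

definition light_family :: "nat \<Rightarrow> real \<Rightarrow> ((nat \<Rightarrow> real) \<times> real) set \<Rightarrow> bool" where
  "light_family n L W \<longleftrightarrow> finite W \<and> card W \<le> n \<and>
     (\<forall>a b. (a, b) \<in> W \<longrightarrow> b \<noteq> 0 \<and> real (card {S. S \<subseteq> {..<n} \<and> sum a S = b}) \<le> L) \<and>
     (\<forall>S. S \<subseteq> {..<n} \<longrightarrow> S \<noteq> {} \<longrightarrow> (\<exists>a b. (a, b) \<in> W \<and> sum a S = b))"

lemma light_familyD:
  assumes "light_family n L W"
  shows "finite W" "card W \<le> n"
    and "\<And>a b. (a, b) \<in> W \<Longrightarrow> b \<noteq> 0"
    and "\<And>a b. (a, b) \<in> W \<Longrightarrow> real (card {S. S \<subseteq> {..<n} \<and> sum a S = b}) \<le> L"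
    and "\<And>S. S \<subseteq> {..<n} \<Longrightarrow> S \<noteq> {} \<Longrightarrow> \<exists>a b. (a, b) \<in> W \<and> sum a S = b"
  using assms unfolding light_family_def by simp_all

lemma light_familyI:
  assumes "finite W" "card W \<le> n"
    and "\<And>a b. (a, b) \<in> W \<Longrightarrow> b \<noteq> 0"
    and "\<And>a b. (a, b) \<in> W \<Longrightarrow> real (card {S. S \<subseteq> {..<n} \<and> sum a S = b}) \<le> L"
    and "\<And>S. S \<subseteq> {..<n} \<Longrightarrow> S \<noteq> {} \<Longrightarrow> \<exists>a b. (a, b) \<in> W \<and> sum a S = b"
  shows "light_family n L W"
  using assms unfolding light_family_def by simp

definition light_cover :: "nat \<Rightarrow> real \<Rightarrow> bool" where
  "light_cover n L \<longleftrightarrow> (\<exists>W. light_family n L W)"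

section \<open>Translation between index sets and cube vertices\<close>

definition hyperplane :: "nat \<Rightarrow> (nat \<Rightarrow> real) \<Rightarrow> real \<Rightarrow> (nat \<Rightarrow> real) set" where
  "hyperplane n a b = {x \<in> real_space n. (\<Sum>i=1..n. a (i - 1) * x i) = b}"

definition vertex :: "nat \<Rightarrow> nat set \<Rightarrow> nat \<Rightarrow> real" where
  "vertex n S = (\<lambda>i\<in>{1..n}. if i - 1 \<in> S then 1 else 0)"

lemma vertex_in_space: "vertex n S \<in> real_space n"
  by (simp add: vertex_def real_space_def)

lemma vertex_empty: "vertex n {} = origin n"
  by (simp add: vertex_def origin_def)

lemma inj_on_vertex: "inj_on (vertex n) (Pow {..<n})"
proof (rule inj_onI)
  fix S T assume S: "S \<in> Pow {..<n}" and T: "T \<in> Pow {..<n}" and eq: "vertex n S = vertex n T"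
  have "i \<in> S \<longleftrightarrow> i \<in> T" if "i < n" for i
    using fun_cong[OF eq, of "Suc i"] that by (auto simp: vertex_def split: if_splits)
  then show "S = T" using S T by blast
qed

lemma vertex_image: "vertex n ` Pow {..<n} = cube n"
proof
  show "vertex n ` Pow {..<n} \<subseteq> cube n" by (auto simp: vertex_def cube_def split: if_splits)
  show "cube n \<subseteq> vertex n ` Pow {..<n}"
  proof
    fix x assume x: "x \<in> cube n"
    have "x = vertex n {i. i < n \<and> x (Suc i) = 1}"
    proof
      fix i show "x i = vertex n {i. i < n \<and> x (Suc i) = 1} i"
      proof (cases "i \<in> {1..n}")
        case True
        then have "x i \<in> {0, 1}" using x unfolding cube_def by (meson PiE_mem)
        then show ?thesis using True by (auto simp: vertex_def)
      next
        case False
        then show ?thesis using PiE_arb[OF x[unfolded cube_def] False] by (simp only: vertex_def restrict_apply if_False)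
      qed
    qed
    then show "x \<in> vertex n ` Pow {..<n}" by auto
  qed
qed

lemma vertex_in_hyperplane:
  assumes "S \<subseteq> {..<n}"
  shows "vertex n S \<in> hyperplane n a b \<longleftrightarrow> sum a S = b"
proof -
  have "(\<Sum>i=1..n. a (i - 1) * vertex n S i) = (\<Sum>i<n. a i * vertex n S (Suc i))"
    by (simp add: sum.atLeast1_atMost_eq)
  also have "\<dots> = (\<Sum>i<n. if i \<in> S then a i else 0)"
    by (rule sum.cong) (auto simp: vertex_def)
  also have "\<dots> = sum a S"
    using assms by (simp add: sum.If_cases Int_absorb1)
  finally show ?thesis by (simp add: hyperplane_def vertex_in_space)
qed

lemma origin_in_hyperplane: "origin n \<in> hyperplane n a b \<longleftrightarrow> b = 0"
  using vertex_in_hyperplane[of "{}" n a b] by (auto simp: vertex_empty)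

lemma card_hyperplane_cube:
  "card (hyperplane n a b \<inter> cube n) = card {S. S \<subseteq> {..<n} \<and> sum a S = b}"
proof -
  have "hyperplane n a b \<inter> cube n = vertex n ` {S. S \<subseteq> {..<n} \<and> sum a S = b}"
    using vertex_in_hyperplane[of _ n a b] by (auto simp flip: vertex_image)
  moreover have "inj_on (vertex n) {S. S \<subseteq> {..<n} \<and> sum a S = b}"
    by (rule inj_on_subset[OF inj_on_vertex]) auto
  ultimately show ?thesis by (simp add: card_image)
qed

lemma affine_hyperplane_hyperplane:
  assumes "i < n" "a i \<noteq> 0"
  shows "affine_hyperplane n (hyperplane n a b)"
proof -
  define c where "c = (\<lambda>i\<in>{1..n}. a (i - 1))"
  have "c \<in> real_space n" by (simp add: c_def real_space_def)
  moreover have "c (Suc i) \<noteq> origin n (Suc i)" using assms by (simp add: c_def origin_def)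
  moreover have "hyperplane n a b = {x \<in> real_space n. (\<Sum>i=1..n. c i * x i) = b}"
    by (simp add: hyperplane_def c_def)
  moreover have "c \<noteq> origin n" using \<open>c (Suc i) \<noteq> origin n (Suc i)\<close> by auto
  ultimately show ?thesis unfolding affine_hyperplane_def by blast
qed

text \<open>A multiple of the first unit vector lies on each of these parallel hyperplanes and
  reveals its level. This provides an infinite supply of distinct hyperplanes for padding.\<close>

lemma inj_hyperplane_const:
  assumes "n \<ge> 1"
  shows "inj (\<lambda>b. hyperplane n (\<lambda>_. 1) b)"
proof (rule injI)
  fix b c assume eq: "hyperplane n (\<lambda>_. 1) b = hyperplane n (\<lambda>_. 1) c"
  define x where "x = (\<lambda>i\<in>{1..n}. if i = 1 then b else 0)"
  have s: "(\<Sum>i=1..n. x i) = b"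
  proof -
    have "(\<Sum>i=1..n. x i) = (\<Sum>i=1..n. if i = 1 then b else 0)"
      by (rule sum.cong) (auto simp: x_def)
    then show ?thesis using assms by simp
  qed
  then have "x \<in> hyperplane n (\<lambda>_. 1) b"
    by (simp add: hyperplane_def) (simp add: x_def real_space_def)
  then have "x \<in> hyperplane n (\<lambda>_. 1) c" using eq by simp
  then show "b = c" using s by (simp add: hyperplane_def)
qed

lemma cover_family_of_light_cover:
  assumes n: "n \<ge> 1" and "light_cover n L"
  obtains \<H> where "cover_family n \<H>" "real (max_load n \<H>) \<le> L"
proof -
  obtain W where "light_family n L W" using assms(2) unfolding light_cover_def by blast
  note W = light_familyD(1,2)[OF this] and nz = light_familyD(3)[OF this]
    and load = light_familyD(4)[OF this] and cov = light_familyD(5)[OF this]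
  \<comment> \<open>A pair whose coefficients all vanish below \<open>n\<close> is no hyperplane.
    Since \<open>b\<close> is nonzero it covers nothing, so dropping it is harmless.\<close>
  define V where "V = {p \<in> W. \<exists>i<n. fst p i \<noteq> 0}"
  define H where "H = (\<lambda>(a, b). hyperplane n a b) ` V"
  have V: "finite V" "card V \<le> n"
    using W card_mono[of W V] by (auto simp: V_def)
  have H: "finite H" "card H \<le> n"
    using V card_image_le[of V "\<lambda>(a, b). hyperplane n a b"] by (auto simp: H_def)
  have Hh: "affine_hyperplane n h \<and> origin n \<notin> h \<and> real (card (h \<inter> cube n)) \<le> L" if h: "h \<in> H" for h
  proof -
    obtain a b i where "(a, b) \<in> W" "i < n" "a i \<noteq> 0" "h = hyperplane n a b"
      using h by (auto simp: H_def V_def)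
    then show ?thesis
      using load nz affine_hyperplane_hyperplane
      by (auto simp: origin_in_hyperplane card_hyperplane_cube)
  qed
  have L0: "L \<ge> 0"
  proof -
    have "{0} \<subseteq> {..<n}" using n by auto
    then obtain a b where "(a, b) \<in> W" using cov[of "{0}"] by blast
    then show ?thesis using load[of a b] by linarith
  qed
  \<comment> \<open>Coordinate sums are nonnegative on the cube, so these hyperplanes have load 0,
    which \<open>L0\<close> makes admissible.\<close>
  define Q where "Q = range (\<lambda>s. hyperplane n (\<lambda>_. 1) (- real (Suc s)))"
  have "inj (\<lambda>s. hyperplane n (\<lambda>_. 1) (- real (Suc s)))"
  proof (rule injI)
    fix s t assume "hyperplane n (\<lambda>_. 1) (- real (Suc s)) = hyperplane n (\<lambda>_. 1) (- real (Suc t))"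
    then have "- real (Suc s) = - real (Suc t)" by (rule injD[OF inj_hyperplane_const[OF n]])
    then show "s = t" by simp
  qed
  then have "infinite Q" unfolding Q_def by (simp add: finite_image_iff)
  \<comment> \<open>Different pairs may give the same hyperplane, so the padding is counted from
    \<open>card H\<close> and chosen outside \<open>H\<close> to reach exactly
    \<open>n\<close>.\<close>
  then have "infinite (Q - H)" using H by simp
  then obtain B where B: "finite B" "card B = n - card H" "B \<subseteq> Q - H"
    using infinite_arbitrarily_large by blast
  have Qh: "affine_hyperplane n h \<and> origin n \<notin> h \<and> real (card (h \<inter> cube n)) \<le> L" if "h \<in> Q" for h
  proof -
    obtain s where s: "h = hyperplane n (\<lambda>_. 1) (- real (Suc s))" using \<open>h \<in> Q\<close> by (auto simp: Q_def)
    have e: "{S. S \<subseteq> {..<n} \<and> (\<Sum>i\<in>S. (1::real)) = - real (Suc s)} = {}"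
    proof (intro equals0I)
      fix S assume "S \<in> {S. S \<subseteq> {..<n} \<and> (\<Sum>i\<in>S. (1::real)) = - real (Suc s)}"
      then have "real (card S) = - real (Suc s)" by simp
      then show False by linarith
    qed
    show ?thesis
      using L0 n affine_hyperplane_hyperplane[of 0 n "\<lambda>_. 1"]
      unfolding s origin_in_hyperplane card_hyperplane_cube e by simp
  qed
  have all: "affine_hyperplane n h \<and> origin n \<notin> h \<and> real (card (h \<inter> cube n)) \<le> L" if "h \<in> H \<union> B" for h
    using that Hh Qh B by blast
  have card: "card (H \<union> B) = n"
    using B H by (subst card_Un_disjoint) auto
  have "covers (H \<union> B) (cube n - {origin n})"
    unfolding covers_def
  proof
    fix x assume x: "x \<in> cube n - {origin n}"
    then obtain S where S: "S \<subseteq> {..<n}" "x = vertex n S" by (auto simp flip: vertex_image)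
    have "S \<noteq> {}" using x S vertex_empty by auto
    then obtain a b where ab: "(a, b) \<in> W" "sum a S = b" using cov S by blast
    have "\<exists>i<n. a i \<noteq> 0"
    proof (rule ccontr)
      assume "\<not> ?thesis"
      then have "sum a S = 0" using S by (intro sum.neutral) auto
      then show False using ab nz by blast
    qed
    then have "hyperplane n a b \<in> H" using ab by (force simp: H_def V_def)
    moreover have "x \<in> hyperplane n a b" using S ab vertex_in_hyperplane by blast
    ultimately show "x \<in> \<Union>(H \<union> B)" by blast
  qed
  then have fam: "cover_family n (H \<union> B)"
    using all card H B by (simp add: cover_family_def)
  have "H \<union> B \<noteq> {}" using card n by auto
  then have "max_load n (H \<union> B) \<in> (\<lambda>h. card (h \<inter> cube n)) ` (H \<union> B)"
    unfolding max_load_def using H B by (intro Max_in) auto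
  then have "real (max_load n (H \<union> B)) \<le> L" using all by auto
  then show thesis using fam that by blast
qed

section \<open>The minimum and the counting bound\<close>

lemma min_max_load_le:
  assumes "cover_family n \<H>"
  shows "min_max_load n \<le> max_load n \<H>"
  unfolding min_max_load_def using assms by (blast intro: Least_le)

lemma min_max_load_attained:
  assumes "cover_family n \<H>"
  obtains \<G> where "cover_family n \<G>" "min_max_load n = max_load n \<G>"
proof -
  have "\<exists>\<G>. cover_family n \<G> \<and> min_max_load n = max_load n \<G>"
    unfolding min_max_load_def by (rule LeastI_ex) (use assms in blast)
  then show thesis using that by blast
qed

lemma card_cube: "card (cube n) = 2 ^ n"
  by (simp add: cube_def card_PiE numeral_2_eq_2)

text \<open>Union bound over the \<open>n\<close> hyperplanes; the summand 1 accounts for the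
  origin.\<close>

lemma max_load_ge:
  assumes "cover_family n \<H>"
  shows "2 ^ n \<le> n * max_load n \<H> + 1"
proof -
  have fin: "finite (cube n)" using card_cube[of n] by (metis card.infinite power_not_zero zero_neq_numeral)
  have H: "finite \<H>" "card \<H> = n" "cube n - {origin n} \<subseteq> \<Union>\<H>"
    using assms by (auto simp: cover_family_def covers_def)
  have "cube n \<subseteq> insert (origin n) (\<Union>h\<in>\<H>. h \<inter> cube n)" using H(3) by blast
  then have "card (cube n) \<le> card (insert (origin n) (\<Union>h\<in>\<H>. h \<inter> cube n))"
    using fin H by (intro card_mono) auto
  also have "\<dots> \<le> Suc (card (\<Union>h\<in>\<H>. h \<inter> cube n))" by (rule card_insert_le_m1) auto
  also have "card (\<Union>h\<in>\<H>. h \<inter> cube n) \<le> (\<Sum>h\<in>\<H>. card (h \<inter> cube n))"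
    by (rule card_UN_le) (rule H)
  also have "\<dots> \<le> (\<Sum>h\<in>\<H>. max_load n \<H>)"
    unfolding max_load_def using H by (intro sum_mono Max_ge) auto
  finally show ?thesis using H by (simp add: card_cube)
qed

text \<open>Old hyperplanes get coefficient 0 in the new coordinate, which doubles their loads. Only
  the new unit vector stays uncovered; one extra hyperplane of load 1 takes care of it.\<close>

lemma light_cover_Suc:
  assumes "light_cover n L" "L \<ge> 1"
  shows "light_cover (Suc n) (2 * L)"
proof -
  obtain W where "light_family n L W" using assms(1) unfolding light_cover_def by blast
  note W = light_familyD(1,2)[OF this] and nz = light_familyD(3)[OF this]
    and load = light_familyD(4)[OF this] and cov = light_familyD(5)[OF this]
  define W1 where "W1 = (\<lambda>(a, b). (a(n := 0), b)) ` W"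
  \<comment> \<open>The new hyperplane contains the single cube point whose only nonzero coordinate is the last.\<close>
  define a1 where "a1 = (\<lambda>i. if i = n then 1 else 2 :: real)"
  have upd: "sum (a(n := 0)) S = sum a (S - {n})" if "S \<subseteq> {..<Suc n}" for a :: "nat \<Rightarrow> real" and S
  proof -
    have "finite S" using that finite_subset by blast
    then have "sum (a(n := 0)) S = sum (a(n := 0)) (S - {n})"
      by (intro sum.mono_neutral_right) auto
    then show ?thesis by simp
  qed
  have sub: "S - {n} \<subseteq> {..<n}" if "S \<subseteq> {..<Suc n}" for S
    using that by (auto simp: less_Suc_eq)
  have single: "S = {n}" if S: "S \<subseteq> {..<Suc n}" "sum a1 S = 1" for S
  proof -
    have fin: "finite S" using S finite_subset by blast
    have "i = n" if "i \<in> S" for i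
    proof (rule ccontr)
      assume "i \<noteq> n"
      then have "2 = sum a1 {i}" by (simp add: a1_def)
      also have "\<dots> \<le> sum a1 S" using fin that by (intro sum_mono2) (auto simp: a1_def)
      finally show False using S by simp
    qed
    moreover have "S \<noteq> {}" using S by auto
    ultimately show ?thesis by blast
  qed
  have "finite (insert (a1, 1) W1)" using W by (simp add: W1_def)
  moreover have "card (insert (a1, 1) W1) \<le> Suc n"
    using W card_image_le[of W "\<lambda>(a, b). (a(n := 0), b)"]
    unfolding W1_def by (intro card_insert_le_m1) auto
  moreover have "b \<noteq> 0 \<and> real (card {S. S \<subseteq> {..<Suc n} \<and> sum a S = b}) \<le> 2 * L"
    if "(a, b) \<in> insert (a1, 1) W1" for a b
  proof (cases "(a, b) = (a1, 1)")
    case True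
    have "{S. S \<subseteq> {..<Suc n} \<and> sum a1 S = 1} \<subseteq> {{n}}" using single by blast
    then have "card {S. S \<subseteq> {..<Suc n} \<and> sum a1 S = 1} \<le> 1"
      using card_mono[of "{{n}}"] by fastforce
    then show ?thesis using True assms(2) by simp
  next
    case False
    then obtain a0 where a0: "(a0, b) \<in> W" "a = a0(n := 0)" using \<open>(a, b) \<in> _\<close> by (auto simp: W1_def)
    let ?A = "{S. S \<subseteq> {..<n} \<and> sum a0 S = b}"
    have fA: "finite ?A" by (rule finite_subset[of _ "Pow {..<n}"]) auto
    have "{S. S \<subseteq> {..<Suc n} \<and> sum a S = b} \<subseteq> ?A \<union> insert n ` ?A"
    proof
      fix S assume "S \<in> {S. S \<subseteq> {..<Suc n} \<and> sum a S = b}"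
      then have S: "S - {n} \<in> ?A" using upd[of S a0] sub[of S] a0 by simp
      moreover have "S = S - {n} \<or> S = insert n (S - {n})" by blast
      ultimately show "S \<in> ?A \<union> insert n ` ?A" by (metis (no_types, lifting) UnI1 UnI2 imageI)
    qed
    then have "card {S. S \<subseteq> {..<Suc n} \<and> sum a S = b} \<le> card (?A \<union> insert n ` ?A)"
      using fA by (intro card_mono) auto
    also have "\<dots> \<le> card ?A + card ?A"
      using card_Un_le[of ?A "insert n ` ?A"] card_image_le[OF fA, of "insert n"] by linarith
    finally show ?thesis using load[OF a0(1)] nz[OF a0(1)] by linarith
  qed
  moreover have "\<exists>a b. (a, b) \<in> insert (a1, 1) W1 \<and> sum a S = b" if S: "S \<subseteq> {..<Suc n}" "S \<noteq> {}" for S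
  proof (cases "S - {n} = {}")
    case True
    then have "S = {n}" using S by blast
    then have "sum a1 S = 1" by (simp add: a1_def)
    then show ?thesis by blast
  next
    case False
    then obtain a b where "(a, b) \<in> W" "sum a (S - {n}) = b" using cov[OF sub] S by blast
    then have "(a(n := 0), b) \<in> W1" "sum (a(n := 0)) S = b"
      using upd S by (force simp: W1_def)+
    then show ?thesis by blast
  qed
  ultimately have "light_family (Suc n) (2 * L) (insert (a1, 1) W1)"
    by (intro light_familyI) blast+
  then show ?thesis unfolding light_cover_def by blast
qed

lemma light_cover_add:
  assumes "light_cover n L" "L \<ge> 1"
  shows "light_cover (n + j) (2 ^ j * L)"
proof (induction j)
  case 0
  then show ?case using assms by simp
next
  case (Suc j)
  have "1 \<le> 2 ^ j * L" using assms(2) mult_mono[of 1 "2 ^ j" 1 L] by simp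
  then show ?case using light_cover_Suc[OF Suc] by (simp add: mult.assoc)
qed

section \<open>Binomial sums along arithmetic progressions\<close>

lemma diff_le_variation:
  fixes f :: "nat \<Rightarrow> real"
  assumes "i \<in> {u..<v}" "j \<in> {u..<v}"
  shows "f j - f i \<le> (\<Sum>l\<in>{u..<v}. \<bar>f (Suc l) - f l\<bar>)"
proof -
  have *: "\<bar>f y - f x\<bar> \<le> (\<Sum>l\<in>{u..<v}. \<bar>f (Suc l) - f l\<bar>)"
    if "x \<in> {u..<v}" "y \<in> {u..<v}" "x \<le> y" for x y
  proof -
    have "f y - f x = (\<Sum>l\<in>{x..<y}. f (Suc l) - f l)"
      using that by (simp add: sum_Suc_diff')
    then have "\<bar>f y - f x\<bar> \<le> (\<Sum>l\<in>{x..<y}. \<bar>f (Suc l) - f l\<bar>)" by simp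
    also have "\<dots> \<le> (\<Sum>l\<in>{u..<v}. \<bar>f (Suc l) - f l\<bar>)"
      using that by (intro sum_mono2) auto
    finally show ?thesis .
  qed
  show ?thesis using *[of i j] *[of j i] assms by (cases "i \<le> j") auto
qed

text \<open>The progression picks one value from each block of length \<open>d\<close>. It exceeds
  every value of its block by at most the variation there; averaging over the block and adding up
  the blocks gives the bound.\<close>

lemma sum_progression_le:
  fixes f :: "nat \<Rightarrow> real"
  assumes "r < d"
  shows "real d * (\<Sum>q<N. f (q * d + r)) \<le>
           (\<Sum>i<N * d. f i) + real d * (\<Sum>i<N * d. \<bar>f (Suc i) - f i\<bar>)"
proof -
  define V where "V q = (\<Sum>l\<in>{q * d..<q * d + d}. \<bar>f (Suc l) - f l\<bar>)" for q
  have "real d * f (q * d + r) \<le> (\<Sum>i\<in>{q * d..<q * d + d}. f i) + real d * V q" for q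
  proof -
    have "real d * f (q * d + r) = (\<Sum>i\<in>{q * d..<q * d + d}. f (q * d + r))" by simp
    also have "\<dots> \<le> (\<Sum>i\<in>{q * d..<q * d + d}. f i + V q)"
    proof (rule sum_mono)
      fix i assume "i \<in> {q * d..<q * d + d}"
      then show "f (q * d + r) \<le> f i + V q"
        unfolding V_def using diff_le_variation[of i "q * d" "q * d + d" "q * d + r" f] assms by auto
    qed
    finally show ?thesis by (simp add: sum.distrib)
  qed
  then have "(\<Sum>q<N. real d * f (q * d + r)) \<le>
      (\<Sum>q<N. (\<Sum>i\<in>{q * d..<q * d + d}. f i) + real d * V q)"
    by (intro sum_mono)
  then show ?thesis
    by (simp add: sum.distrib sum.nat_group V_def flip: sum_distrib_left)
qed

text \<open>A row of binomial coefficients rises to the middle and then falls, so each half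
  telescopes to at most the peak. The last step goes from \<open>m choose m\<close> down to
  0.\<close>

lemma binomial_variation:
  "(\<Sum>i<m + 1. \<bar>real (m choose Suc i) - real (m choose i)\<bar>) \<le> 2 * real (m choose (m div 2))"
proof -
  define h where "h = m div 2"
  define f where "f i = real (m choose i)" for i
  have "{..<m + 1} = {..<h} \<union> {h..<m + 1}" by (auto simp: h_def)
  moreover have "sum g ({..<h} \<union> {h..<m + 1}) = sum g {..<h} + sum g {h..<m + 1}" for g :: "nat \<Rightarrow> real"
    by (rule sum.union_disjoint) auto
  ultimately have "(\<Sum>i<m + 1. \<bar>f (Suc i) - f i\<bar>) =
      (\<Sum>i<h. \<bar>f (Suc i) - f i\<bar>) + (\<Sum>i\<in>{h..<m + 1}. \<bar>f (Suc i) - f i\<bar>)"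
    by simp
  also have "(\<Sum>i<h. \<bar>f (Suc i) - f i\<bar>) = (\<Sum>i<h. f (Suc i) - f i)"
  proof (rule sum.cong)
    fix i assume "i \<in> {..<h}"
    then have "f i \<le> f (Suc i)"
      unfolding f_def h_def of_nat_le_iff by (intro binomial_mono) auto
    then show "\<bar>f (Suc i) - f i\<bar> = f (Suc i) - f i" by simp
  qed simp
  also have "\<dots> = f h - f 0" by (rule sum_lessThan_telescope)
  also have "(\<Sum>i\<in>{h..<m + 1}. \<bar>f (Suc i) - f i\<bar>) = (\<Sum>i\<in>{h..<m + 1}. - (f (Suc i) - f i))"
  proof (rule sum.cong)
    fix i assume i: "i \<in> {h..<m + 1}"
    have "f (Suc i) \<le> f i"
    proof (cases "i = m")
      case False
      then show ?thesis using i unfolding f_def h_def of_nat_le_iff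
        by (intro binomial_antimono) auto
    qed (simp add: f_def binomial_eq_0)
    then show "\<bar>f (Suc i) - f i\<bar> = - (f (Suc i) - f i)" by simp
  qed simp
  also have "\<dots> = f h - f (m + 1)"
    unfolding sum_negf by (subst sum_Suc_diff') (auto simp: h_def)
  finally show ?thesis by (simp add: f_def h_def)
qed

text \<open>Since \<open>N * d = m + 1\<close>, the blocks tile \<open>{0..m}\<close> exactly and
  the full sum is the row sum \<open>2 ^ m\<close>.\<close>

lemma sum_binomial_progression_le:
  assumes "r < d" "N * d = m + 1"
  shows "(\<Sum>q<N. real (m choose (q * d + r))) \<le> 2 ^ m / d + 2 * real (m choose (m div 2))"
proof -
  have "(\<Sum>i<m + 1. real (m choose i)) = 2 ^ m"
    using choose_row_sum[of m] by (simp flip: of_nat_sum add: lessThan_Suc_atMost)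
  then have "real d * (\<Sum>q<N. real (m choose (q * d + r))) \<le>
      2 ^ m + real d * (2 * real (m choose (m div 2)))"
    using sum_progression_le[OF assms(1), of "\<lambda>i. real (m choose i)" N]
      mult_left_mono[OF binomial_variation[of m], of "real d"] unfolding assms(2) by linarith
  then show ?thesis using assms(1) by (simp add: field_simps)
qed

text \<open>The factor \<open>2 * p + 1\<close> makes the induction close: consecutive central
  coefficients have ratio \<open>2 * (2 * p + 1) / (p + 1)\<close>, and
  \<open>(2 * p + 1) * (2 * p + 3) \<le> 4 * (p + 1) ^ 2\<close>.\<close>

lemma central_binomial_even_le: "(2 * p + 1) * (2 * p choose p) ^ 2 \<le> 16 ^ p"
proof (induction p)
  case 0
  then show ?case by simp
next
  case (Suc p)
  let ?c = "2 * p choose p" and ?e = "2 * Suc p choose Suc p"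
  have "Suc p * ?e = (2 * p + 2) * (2 * p + 1 choose p)"
    using Suc_times_binomial_eq[of "2 * p + 1" p] by (simp add: mult.commute)
  then have "Suc p * ?e = Suc p * (2 * (2 * p + 1 choose p))" by simp
  then have 1: "?e = 2 * (2 * p + 1 choose p)" by (subst (asm) mult_cancel1) simp
  have "(2 * p + 1 choose p) = (2 * p + 1 choose Suc p)"
    using binomial_symmetric[of p "2 * p + 1"] by simp
  then have 2: "(p + 1) * (2 * p + 1 choose p) = (2 * p + 1) * ?c"
    using Suc_times_binomial_eq[of "2 * p" p] by (simp add: mult.commute)
  have 3: "(p + 1) * ?e = 2 * (2 * p + 1) * ?c"
  proof -
    have "(p + 1) * ?e = 2 * ((p + 1) * (2 * p + 1 choose p))" unfolding 1 by (rule mult.left_commute)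
    then show ?thesis unfolding 2 by (simp only: mult.assoc)
  qed
  \<comment> \<open>Multiplying by \<open>(p + 1) ^ 2\<close> lets the recurrence be used without
    division; the factor is cancelled at the end.\<close>
  have "(p + 1) ^ 2 * ((2 * p + 3) * ?e ^ 2) = (2 * p + 3) * ((p + 1) * ?e) ^ 2"
    by (simp only: power_mult_distrib mult.left_commute)
  also have "\<dots> = 4 * ((2 * p + 3) * (2 * p + 1)) * ((2 * p + 1) * ?c ^ 2)"
    unfolding 3 by (simp add: power2_eq_square algebra_simps)
  also have "\<dots> \<le> 4 * (4 * (p + 1) ^ 2) * 16 ^ p"
    by (rule mult_le_mono[OF mult_le_mono[OF le_refl] Suc.IH]) (simp add: power2_eq_square algebra_simps)
  also have "\<dots> = (p + 1) ^ 2 * 16 ^ Suc p" by simp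
  finally have "(2 * p + 3) * ?e ^ 2 \<le> 16 ^ Suc p" by simp
  moreover have "2 * Suc p + 1 = 2 * p + 3" by simp
  ultimately show ?case by (simp only:)
qed

lemma central_binomial_le: "real (m choose (m div 2)) \<le> 2 ^ m / sqrt (m + 1)"
proof -
  have "(m + 1) * (m choose (m div 2)) ^ 2 \<le> 4 ^ m"
  proof (cases "even m")
    case True
    then obtain p where p: "m = 2 * p" by blast
    have "(4::nat) ^ m = 16 ^ p" by (simp add: p power_mult)
    then show ?thesis using central_binomial_even_le[of p] by (simp add: p)
  next
    case False
    then obtain p where p: "m = 2 * p + 1" by (elim oddE)
    \<comment> \<open>By Pascal's rule and symmetry the odd case is half of the next even central
      coefficient.\<close>
    have "(2 * Suc p choose Suc p) = 2 * (m choose (m div 2))"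
      using binomial_symmetric[of p "2 * p + 1"] by (simp add: p)
    then have "(2 * p + 3) * (4 * (m choose (m div 2)) ^ 2) \<le> 16 ^ Suc p"
      using central_binomial_even_le[of "Suc p"] by (simp add: numeral_3_eq_3)
    moreover have "4 * (4::nat) ^ m = 16 ^ Suc p" by (simp add: p power_mult)
    moreover have "(m + 1) * (m choose (m div 2)) ^ 2 \<le> (2 * p + 3) * (m choose (m div 2)) ^ 2"
      by (intro mult_right_mono) (auto simp: p)
    ultimately show ?thesis by linarith
  qed
  then have "real ((m + 1) * (m choose (m div 2)) ^ 2) \<le> real (4 ^ m)" by (rule of_nat_mono)
  moreover have "(sqrt (m + 1) * real (m choose (m div 2))) ^ 2 = real ((m + 1) * (m choose (m div 2)) ^ 2)"
    by (simp add: power_mult_distrib algebra_simps)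
  moreover have "real (4 ^ m) = (2 ^ m) ^ 2" by (simp add: power_mult flip: power_even_eq)
  ultimately have "(sqrt (m + 1) * real (m choose (m div 2))) ^ 2 \<le> (2 ^ m) ^ 2" by simp
  then have "sqrt (m + 1) * real (m choose (m div 2)) \<le> 2 ^ m"
    by (rule power2_le_imp_le) simp
  then show ?thesis by (simp add: field_simps)
qed

section \<open>The construction\<close>

lemma set_encode_less:
  assumes "A \<subseteq> {..<k}"
  shows "set_encode A < 2 ^ k"
proof -
  have "set_encode A \<le> (\<Sum>i<k. 2 ^ i)"
    unfolding set_encode_def using assms by (intro sum_mono2) auto
  also have "\<dots> < 2 ^ k" by (induction k) auto
  finally show ?thesis .
qed

lemma set_decode_subset:
  assumes "q < 2 ^ k"
  shows "set_decode q \<subseteq> {..<k}"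
proof
  fix i assume i: "i \<in> set_decode q"
  show "i \<in> {..<k}"
  proof (rule ccontr)
    assume "i \<notin> {..<k}"
    then have "(2::nat) ^ k \<le> 2 ^ i" by (intro power_increasing) auto
    then have "q div 2 ^ i = 0" using assms by (intro div_less) linarith
    then show False using i by (simp add: set_decode_def)
  qed
qed

text \<open>Each element of \<open>Y\<close> toggles one bit of \<open>T\<close>: it removes
  \<open>2 ^ i\<close> if the bit was set and adds it otherwise.\<close>

lemma set_encode_sym_diff:
  assumes "finite T" "finite Y"
  shows "real (set_encode (sym_diff T Y)) =
           real (set_encode T) + (\<Sum>i\<in>Y. if i \<in> T then - (2 ^ i) else 2 ^ i)"
proof -
  have e: "real (set_encode A) = (\<Sum>i\<in>A. 2 ^ i)" for A
    by (simp add: set_encode_def)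
  have "(\<Sum>i\<in>sym_diff T Y. 2 ^ i :: real) = (\<Sum>i\<in>T - Y. 2 ^ i) + (\<Sum>i\<in>Y - T. 2 ^ i)"
    using assms by (intro sum.union_disjoint) auto
  moreover have "(\<Sum>i\<in>T. 2 ^ i :: real) = (\<Sum>i\<in>T \<inter> Y. 2 ^ i) + (\<Sum>i\<in>T - Y. 2 ^ i)"
    by (rule sum.Int_Diff) (rule assms)
  moreover have "(\<Sum>i\<in>Y. if i \<in> T then - (2 ^ i) else 2 ^ i :: real) =
      (\<Sum>i\<in>Y \<inter> T. - (2 ^ i)) + (\<Sum>i\<in>Y - T. 2 ^ i)"
    using assms by (simp add: sum.If_cases Diff_eq)
  ultimately show ?thesis unfolding e by (simp add: sum_negf Int_commute)
qed

text \<open>Once the value \<open>q\<close> of the encoded symmetric difference is fixed, the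
  coordinates below \<open>k\<close> are forced to be \<open>sym_diff T (set_decode q)\<close>. Only
  the upper part is free, and its size is prescribed.\<close>

lemma card_layers_le:
  assumes T: "T \<subseteq> {..<k}"
  shows "card {S. S \<subseteq> {..<m + k} \<and>
                  card (S - {..<k}) = set_encode (sym_diff T (S \<inter> {..<k})) * d + r}
           \<le> (\<Sum>q<2 ^ k. m choose (q * d + r))"
proof -
  let ?X = "\<lambda>q. {X. X \<subseteq> {k..<m + k} \<and> card X = q * d + r}"
  let ?U = "\<Union>q\<in>{..<2 ^ k}. (\<lambda>X. sym_diff T (set_decode q) \<union> X) ` ?X q"
  have fX: "finite (?X q)" for q by (rule finite_subset[of _ "Pow {k..<m + k}"]) auto
  have "{S. S \<subseteq> {..<m + k} \<and>
           card (S - {..<k}) = set_encode (sym_diff T (S \<inter> {..<k})) * d + r} \<subseteq> ?U"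
  proof
    fix S assume "S \<in> {S. S \<subseteq> {..<m + k} \<and>
           card (S - {..<k}) = set_encode (sym_diff T (S \<inter> {..<k})) * d + r}"
    then have S: "S \<subseteq> {..<m + k}"
      "card (S - {..<k}) = set_encode (sym_diff T (S \<inter> {..<k})) * d + r" by auto
    define q where "q = set_encode (sym_diff T (S \<inter> {..<k}))"
    have sub: "sym_diff T (S \<inter> {..<k}) \<subseteq> {..<k}" using T by auto
    then have q: "q < 2 ^ k" unfolding q_def by (rule set_encode_less)
    have "set_decode q = sym_diff T (S \<inter> {..<k})"
      unfolding q_def by (rule set_encode_inverse) (rule finite_subset[OF sub finite_lessThan])
    then have "sym_diff T (set_decode q) = S \<inter> {..<k}" by blast
    then have "S = sym_diff T (set_decode q) \<union> (S - {..<k})" by blast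
    moreover have "S - {..<k} \<in> ?X q" using S by (auto simp: q_def)
    ultimately show "S \<in> ?U" using q by blast
  qed
  then have "card {S. S \<subseteq> {..<m + k} \<and>
           card (S - {..<k}) = set_encode (sym_diff T (S \<inter> {..<k})) * d + r} \<le> card ?U"
    using fX by (intro card_mono) auto
  also have "\<dots> \<le> (\<Sum>q<2 ^ k. card ((\<lambda>X. sym_diff T (set_decode q) \<union> X) ` ?X q))"
    by (rule card_UN_le) simp
  also have "\<dots> \<le> (\<Sum>q<2 ^ k. card (?X q))"
    by (intro sum_mono card_image_le fX)
  also have "\<dots> = (\<Sum>q<2 ^ k. m choose (q * d + r))"
    by (simp add: n_subsets)
  finally show ?thesis .
qed

text \<open>
  Read a set of coordinates below \<open>k\<close> as a binary number. For fixed \<open>T\<close> the number of \<open>sym_diff T Y\<close>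
  is affine in the indicator of \<open>Y\<close>, because the signs in \<open>set_encode_sym_diff\<close> depend on \<open>T\<close> only;
  this is what turns the layers below into hyperplanes.
\<close>

definition layer_coeff :: "nat \<Rightarrow> nat \<Rightarrow> nat set \<Rightarrow> nat \<Rightarrow> real" where
  "layer_coeff k d T i = (if i < k then - (real d * (if i \<in> T then - (2 ^ i) else 2 ^ i)) else 1)"

lemma sum_layer_coeff:
  assumes "finite S" "T \<subseteq> {..<k}"
  shows "sum (layer_coeff k d T) S =
    real (card (S - {..<k})) -
    real d * (real (set_encode (sym_diff T (S \<inter> {..<k}))) - real (set_encode T))"
proof -
  have T: "finite T" using assms(2) finite_subset by blast
  have "sum (layer_coeff k d T) S =
      sum (layer_coeff k d T) (S \<inter> {..<k}) + sum (layer_coeff k d T) (S - {..<k})"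
    by (rule sum.Int_Diff) (rule assms)
  also have "sum (layer_coeff k d T) (S - {..<k}) = real (card (S - {..<k}))"
    by (simp add: layer_coeff_def)
  also have "sum (layer_coeff k d T) (S \<inter> {..<k}) =
      (\<Sum>i\<in>S \<inter> {..<k}. - (real d * (if i \<in> T then - (2 ^ i) else 2 ^ i)))"
    by (rule sum.cong) (auto simp: layer_coeff_def)
  also have "\<dots> = - (real d * (\<Sum>i\<in>S \<inter> {..<k}. if i \<in> T then - (2 ^ i) else 2 ^ i))"
    by (simp only: sum_negf sum_distrib_left)
  also have "(\<Sum>i\<in>S \<inter> {..<k}. if i \<in> T then - (2 ^ i) else 2 ^ i) =
      real (set_encode (sym_diff T (S \<inter> {..<k}))) - real (set_encode T)"
    using set_encode_sym_diff[OF T, of "S \<inter> {..<k}"] assms(1) by simp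
  finally show ?thesis by simp
qed

text \<open>The constant term of the affine form moves to the right-hand side. For
  \<open>d > 0\<close> that side vanishes only at \<open>T = {}\<close>, \<open>r = 0\<close>, so
  exactly one layer contains the origin.\<close>

lemma sum_layer_coeff_eq_iff:
  assumes "finite S" "T \<subseteq> {..<k}"
  shows "sum (layer_coeff k d T) S = real (set_encode T * d + r) \<longleftrightarrow>
    card (S - {..<k}) = set_encode (sym_diff T (S \<inter> {..<k})) * d + r"
proof -
  have "sum (layer_coeff k d T) S = real (set_encode T * d + r) \<longleftrightarrow>
      real (card (S - {..<k})) = real (set_encode (sym_diff T (S \<inter> {..<k})) * d + r)"
    unfolding sum_layer_coeff[OF assms] by (simp add: algebra_simps)
  then show ?thesis by (simp only: of_nat_eq_iff)
qed

lemma light_cover_construction: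
  fixes m k d :: nat
  assumes m: "2 ^ k * d = m + 1"
  shows "light_cover (m + k) (2 ^ m / d + 2 * (2 ^ m / sqrt (m + 1)))"
proof -
  let ?n = "m + k" and ?L = "2 ^ m / d + 2 * (2 ^ m / sqrt (m + 1))"
  let ?c = "layer_coeff k d"
  \<comment> \<open>\<open>M\<close> exceeds every possible size of the upper part, which is at most
    \<open>m\<close>.\<close>
  define M where "M = real (m + 1)"
  have d: "d > 0" using m by (cases d) auto
  define I where "I = Pow {..<k} \<times> {..<d} - {({}, 0)}"
  define g where "g p = (?c (fst p), real (set_encode (fst p) * d + snd p))" for p
  \<comment> \<open>The family omits the layer \<open>({}, 0)\<close>, which passes through the origin. Its other points
    all have some nonzero coordinate \<open>i < k\<close>, and the hyperplane \<open>special i\<close> agrees with the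
    omitted one where coordinate \<open>i\<close> is 1 and misses the cube where it is 0.\<close>
  define special where "special i = ((?c {})(i := ?c {} i + M), M)" for i
  have special_sum: "sum ((?c {})(i := ?c {} i + M)) S =
      sum (?c {}) S + (if i \<in> S then M else 0)" if "finite S" for i S
  proof -
    have "sum ((?c {})(i := ?c {} i + M)) S = (\<Sum>j\<in>S. ?c {} j + (if i = j then M else 0))"
      by (rule sum.cong) auto
    then show ?thesis using that by (simp add: sum.distrib)
  qed
  have layer_load: "real (card {S. S \<subseteq> {..<?n} \<and>
      card (S - {..<k}) = set_encode (sym_diff T (S \<inter> {..<k})) * d + r}) \<le> ?L"
    if T: "T \<subseteq> {..<k}" and r: "r < d" for T r
  proof -
    have "real (card {S. S \<subseteq> {..<?n} \<and>
        card (S - {..<k}) = set_encode (sym_diff T (S \<inter> {..<k})) * d + r}) \<le>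
        real (\<Sum>q<2 ^ k. m choose (q * d + r))"
      using card_layers_le[OF T] by (rule of_nat_mono)
    also have "\<dots> \<le> 2 ^ m / d + 2 * real (m choose (m div 2))"
      using sum_binomial_progression_le[OF r m] by simp
    also have "\<dots> \<le> ?L" using central_binomial_le[of m] by simp
    finally show ?thesis .
  qed
  have cardX: "card (S - {..<k}) \<le> m" if "S \<subseteq> {..<?n}" for S
  proof -
    have "card (S - {..<k}) \<le> card {k..<?n}" using that by (intro card_mono) auto
    then show ?thesis by simp
  qed
  have fin: "finite S" if "S \<subseteq> {..<?n}" for S using that finite_subset by blast
  have mem: "(\<exists>T r. T \<subseteq> {..<k} \<and> r < d \<and> (T, r) \<noteq> ({}, 0) \<and> p = g (T, r)) \<or> (\<exists>i<k. p = special i)"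
    if "p \<in> g ` I \<union> special ` {..<k}" for p
    using that
  proof
    assume "p \<in> g ` I"
    then obtain z where z: "z \<in> I" "p = g z" by blast
    obtain T r where "z = (T, r)" by (cases z)
    then show ?thesis using z unfolding I_def by (intro disjI1 exI[of _ T] exI[of _ r]) simp
  qed blast
  have "light_family ?n ?L (g ` I \<union> special ` {..<k})"
  proof (rule light_familyI)
    show "finite (g ` I \<union> special ` {..<k})" by (simp add: I_def)
    \<comment> \<open>There are \<open>2 ^ k * d = m + 1\<close> layers, one of which is omitted;
      with the \<open>k\<close> special hyperplanes the budget \<open>m + k\<close> is met.\<close>
    have "card I = m" unfolding I_def using m d by (simp add: card_Diff_singleton card_Pow)
    then have "card (g ` I) \<le> m" using card_image_le[of I g] by (simp add: I_def)
    moreover have "card (special ` {..<k}) \<le> k" using card_image_le[of "{..<k}" special] by simp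
    ultimately show "card (g ` I \<union> special ` {..<k}) \<le> ?n"
      using card_Un_le[of "g ` I" "special ` {..<k}"] by linarith
  next
    fix a b assume "(a, b) \<in> g ` I \<union> special ` {..<k}"
    then consider (layer) T r where "T \<subseteq> {..<k}" "r < d" "(T, r) \<noteq> ({}, 0)" "(a, b) = g (T, r)"
      | (special) i where "i < k" "(a, b) = special i"
      using mem by blast
    then show "b \<noteq> 0"
    proof cases
      case layer
      have "set_encode T \<noteq> 0 \<or> r \<noteq> 0"
        using layer(3) set_encode_eq[OF finite_subset[OF layer(1)], of "{}"] by auto
      then have "set_encode T * d + r \<noteq> 0" using d by simp
      then have "real (set_encode T * d + r) \<noteq> 0" by (simp only: of_nat_eq_0_iff not_False_eq_True)
      then show ?thesis using layer(4) by (simp only: g_def prod.inject fst_conv snd_conv not_False_eq_True)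
    qed (simp add: special_def M_def)
  next
    fix a b assume "(a, b) \<in> g ` I \<union> special ` {..<k}"
    then consider (layer) T r where "T \<subseteq> {..<k}" "r < d" "(a, b) = g (T, r)"
      | (special) i where "i < k" "(a, b) = special i"
      using mem by blast
    then show "real (card {S. S \<subseteq> {..<?n} \<and> sum a S = b}) \<le> ?L"
    proof cases
      case layer
      have "{S. S \<subseteq> {..<?n} \<and> sum a S = b} = {S. S \<subseteq> {..<?n} \<and>
          card (S - {..<k}) = set_encode (sym_diff T (S \<inter> {..<k})) * d + r}"
        using sum_layer_coeff_eq_iff[OF fin layer(1)] layer(3) by (auto simp: g_def)
      then show ?thesis using layer_load[OF layer(1,2)] by simp
    next
      case special
      have "{S. S \<subseteq> {..<?n} \<and> sum a S = b} \<subseteq> {S. S \<subseteq> {..<?n} \<and>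
          card (S - {..<k}) = set_encode (sym_diff {} (S \<inter> {..<k})) * d + 0}" (is "?A \<subseteq> ?B")
      proof
        fix S assume "S \<in> ?A"
        then have S: "S \<subseteq> {..<?n}" and "sum (?c {}) S + (if i \<in> S then M else 0) = M"
          using special(2) special_sum[OF fin] by (auto simp: special_def)
        \<comment> \<open>The coefficients of \<open>?c {}\<close> below \<open>k\<close> are
          negative, so the sum is at most the size of the upper part. Hence the level
          \<open>M\<close> is reached only with \<open>i \<in> S\<close>, and then the point lies in
          the omitted layer.\<close>
        moreover have "sum (?c {}) S < M"
        proof -
          have "sum (?c {}) S \<le> real (card (S - {..<k}))"
            using sum_layer_coeff[OF fin[OF S], of "{}" k d] by simp
          then show ?thesis using cardX[OF S] by (simp add: M_def)
        qed
        ultimately have "sum (?c {}) S = real (set_encode {} * d + 0)" by (auto split: if_splits)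
        then show "S \<in> ?B" using sum_layer_coeff_eq_iff[OF fin[OF S], of "{}" k d 0] S by simp
      qed
      moreover have "finite ?B" by (rule finite_subset[of _ "Pow {..<?n}"]) auto
      ultimately have "card ?A \<le> card ?B" by (intro card_mono)
      then show ?thesis using layer_load[of "{}" 0] d by simp
    qed
  next
    fix S assume S: "S \<subseteq> {..<?n}" "S \<noteq> {}"
    define Y where "Y = S \<inter> {..<k}"
    define q where "q = card (S - {..<k}) div d"
    define r where "r = card (S - {..<k}) mod d"
    have r: "r < d" using d by (simp add: r_def)
    have qr: "card (S - {..<k}) = q * d + r" by (simp add: q_def r_def)
    have "card (S - {..<k}) < 2 ^ k * d" using cardX[OF S(1)] m by simp
    then have "q < 2 ^ k" unfolding q_def using d by (simp add: less_mult_imp_div_less)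
    then have dq: "set_decode q \<subseteq> {..<k}" by (rule set_decode_subset)
    \<comment> \<open>This solves \<open>sym_diff T Y = set_decode q\<close> for \<open>T\<close>,
      selecting the layer that contains \<open>S\<close>.\<close>
    define T where "T = sym_diff (set_decode q) Y"
    have T: "T \<subseteq> {..<k}" using dq by (auto simp: T_def Y_def)
    have "sym_diff T Y = set_decode q" by (auto simp: T_def)
    then have sol: "sum (?c T) S = real (set_encode T * d + r)"
      using sum_layer_coeff_eq_iff[OF fin[OF S(1)] T, of d r] qr by (simp add: Y_def)
    show "\<exists>a b. (a, b) \<in> g ` I \<union> special ` {..<k} \<and> sum a S = b"
    proof (cases "(T, r) = ({}, 0)")
      case False
      then have "g (T, r) \<in> g ` I" using T r by (intro imageI) (simp add: I_def)
      then have "(?c T, real (set_encode T * d + r)) \<in> g ` I" by (simp only: g_def fst_conv snd_conv)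
      then show ?thesis using sol by blast
    next
      case True
      \<comment> \<open>In the omitted layer an empty \<open>Y\<close> forces an empty upper part,
        that is, the origin. Otherwise any \<open>i \<in> Y\<close> gives a special hyperplane
        through \<open>S\<close>.\<close>
      have "Y \<noteq> {}"
      proof
        assume "Y = {}"
        then have "set_decode q = {}" using True T_def by simp
        then have "q = 0" using set_decode_inverse[of q] by simp
        then have "card (S - {..<k}) = 0" using True qr by simp
        then have "S - {..<k} = {}" using fin[OF S(1)] by simp
        then show False using \<open>Y = {}\<close> S(2) by (auto simp: Y_def)
      qed
      then obtain i where i: "i \<in> S" "i < k" by (auto simp: Y_def)
      have "sum (?c {}) S = 0" using sol True by simp
      then have "sum ((?c {})(i := ?c {} i + M)) S = M"
        using special_sum[OF fin[OF S(1)], of i] i by simp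
      moreover have "((?c {})(i := ?c {} i + M), M) \<in> special ` {..<k}"
        using i by (auto simp: special_def)
      ultimately show ?thesis by blast
    qed
  qed
  then show ?thesis unfolding light_cover_def by blast
qed

section \<open>Asymptotics\<close>

lemma min_max_load_upper:
  fixes m k d n :: nat
  assumes m: "2 ^ k * d = m + 1" and n: "m + k \<le> n" "n \<ge> 1"
  shows "real (min_max_load n) / 2 ^ n \<le> 1 / real (m + 1) + 2 / (2 ^ k * sqrt (real (m + 1)))"
    and "\<exists>\<H>. cover_family n \<H>"
proof -
  let ?L = "2 ^ m / real d + 2 * (2 ^ m / sqrt (real (m + 1)))"
  have d: "d > 0" using m by (cases d) auto
  \<comment> \<open>This makes the load bound at least 1, as adding dimensions requires.\<close>
  have "d \<le> 2 ^ m"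
  proof -
    have "d \<le> m + 1" unfolding m[symmetric] by simp
    also have "\<dots> \<le> 2 ^ m" using Suc_leI[OF less_exp[of m]] by simp
    finally show ?thesis .
  qed
  then have "real d \<le> 2 ^ m" using of_nat_mono[of d "2 ^ m"] by simp
  then have "1 \<le> 2 ^ m / d" using d by simp
  moreover have "0 \<le> 2 * (2 ^ m / sqrt (real (m + 1)))" by simp
  ultimately have "1 \<le> ?L" by linarith
  then have "light_cover (m + k + (n - (m + k))) (2 ^ (n - (m + k)) * ?L)"
    by (intro light_cover_add light_cover_construction m)
  then have "light_cover n (2 ^ (n - (m + k)) * ?L)" using n by simp
  then obtain \<H> where H: "cover_family n \<H>" "real (max_load n \<H>) \<le> 2 ^ (n - (m + k)) * ?L"
    using cover_family_of_light_cover[OF n(2)] by blast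
  show "\<exists>\<H>. cover_family n \<H>" using H by blast
  have "real (min_max_load n) \<le> 2 ^ (n - (m + k)) * ?L"
    using min_max_load_le[OF H(1)] H(2) by linarith
  moreover have "2 ^ n = (2 ^ (n - (m + k)) * (2 ^ m * 2 ^ k) :: real)"
    using n by (simp flip: power_add)
  ultimately have "real (min_max_load n) / 2 ^ n \<le> ?L / (2 ^ m * 2 ^ k)"
    by (simp add: divide_le_cancel field_simps)
  also have "\<dots> = 1 / (2 ^ k * real d) + 2 / (2 ^ k * sqrt (real (m + 1)))"
    using d by (simp add: field_simps)
  also have "2 ^ k * real d = real (m + 1)"
    unfolding m[symmetric] by simp
  finally show "real (min_max_load n) / 2 ^ n \<le> 1 / real (m + 1) + 2 / (2 ^ k * sqrt (real (m + 1)))" .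
qed

lemma power_two_between:
  fixes x :: real
  assumes "x \<ge> 1"
  obtains k :: nat where "2 ^ k \<le> x" "x < 2 * 2 ^ k"
proof -
  define k where "k = nat \<lfloor>log 2 x\<rfloor>"
  have "log 2 x \<ge> 0" using assms by simp
  then have "real k \<le> log 2 x" "log 2 x < real k + 1" by (simp_all add: k_def)
  then have "2 powr real k \<le> x" "x < 2 powr (real k + 1)"
    using assms by (simp_all add: le_log_iff log_less_iff)
  then show thesis using that[of k] by (simp add: powr_realpow powr_add)
qed

text \<open>Rounding \<open>m + 1\<close> to a multiple of \<open>2 ^ k\<close> must cost
  \<open>o(n)\<close> dimensions, while the error \<open>n / (2 ^ k * sqrt n)\<close> must vanish.
  Any power of \<open>n\<close> with exponent strictly between 1/2 and 1 serves for
  \<open>2 ^ k\<close>; 3/4 is the midpoint.\<close>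

lemma scaled_load_upper:
  fixes n :: nat
  assumes n: "n \<ge> 1" and pos: "real n - 2 * real n powr (3/4) > 0"
  shows "real n * real (min_max_load n) / 2 ^ n \<le>
      real n / (real n - 2 * real n powr (3/4)) +
      4 * real n / (real n powr (3/4) * sqrt (real n - 2 * real n powr (3/4)))"
    and "\<exists>\<H>. cover_family n \<H>"
proof -
  define x where "x = real n powr (3/4)"
  define y where "y = real n - 2 * x"
  have y: "y > 0" using pos by (simp add: x_def y_def)
  have "x \<ge> 1" using n by (simp add: x_def ge_one_powr_ge_zero)
  then obtain k :: nat where k: "2 ^ k \<le> x" "x < 2 * 2 ^ k" by (rule power_two_between)
  have "real k \<le> 2 ^ k" by (rule less_imp_le[OF of_nat_less_two_power])
  then have kx: "real k \<le> x" using k(1) by linarith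
  \<comment> \<open>The largest \<open>d\<close> for which \<open>m + 1 = 2 ^ k * d\<close> still
    satisfies \<open>m + k \<le> n\<close>. Fewer than \<open>2 ^ k\<close> dimensions are lost to
    rounding and \<open>k\<close> to the binary part, together at most \<open>2 * x\<close>.\<close>
  define d where "d = (n + 1 - k) div 2 ^ k"
  have kn: "real k + 2 ^ k < real n" using kx k(1) y by (simp add: y_def)
  have "n + 1 - k = 2 ^ k * d + (n + 1 - k) mod 2 ^ k" by (simp add: d_def)
  moreover have "(n + 1 - k) mod 2 ^ k < 2 ^ k" by simp
  ultimately have lo: "n + 1 - k < 2 ^ k * d + 2 ^ k" and hi: "2 ^ k * d \<le> n + 1 - k" by linarith+
  have "real k \<le> real n" using kn zero_le_power[of "2::real" k] by linarith
  then have "k \<le> n" using of_nat_le_iff[of k n, where 'a = real] by simp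
  have "real (n + 1 - k) < real (2 ^ k * d + 2 ^ k)" using lo by (simp only: of_nat_less_iff)
  then have "real n + 1 - real k < real (2 ^ k * d) + 2 ^ k"
    using \<open>k \<le> n\<close> by (simp add: of_nat_diff)
  then have My: "y \<le> real (2 ^ k * d)" using kx k(1) by (simp add: y_def)
  then have "real (2 ^ k * d) > 0" using y by linarith
  then have "2 ^ k * d > 0" by (simp only: of_nat_0_less_iff)
  then have "2 ^ k * d = 2 ^ k * d - 1 + 1" by simp
  then obtain m where m: "2 ^ k * d = m + 1" by blast
  have mk: "m + k \<le> n" using hi m \<open>k \<le> n\<close> by linarith
  note bound = min_max_load_upper[OF m mk n]
  show "\<exists>\<H>. cover_family n \<H>" by (rule bound)
  have My: "y \<le> real (m + 1)" using My m by simp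
  have "real (min_max_load n) / 2 ^ n \<le> 1 / real (m + 1) + 2 / (2 ^ k * sqrt (real (m + 1)))"
    by (rule bound)
  also have "\<dots> \<le> 1 / y + 2 / (x / 2 * sqrt y)"
  proof (intro add_mono divide_left_mono mult_mono)
    show "x / 2 \<le> 2 ^ k" using k by simp
    show "sqrt y \<le> sqrt (real (m + 1))" using My by (rule real_sqrt_le_mono)
  qed (use My y \<open>x \<ge> 1\<close> in auto)
  finally have "real n * (real (min_max_load n) / 2 ^ n) \<le> real n * (1 / y + 2 / (x / 2 * sqrt y))"
    by (rule mult_left_mono) simp
  then show "real n * real (min_max_load n) / 2 ^ n \<le>
      real n / (real n - 2 * real n powr (3/4)) +
      4 * real n / (real n powr (3/4) * sqrt (real n - 2 * real n powr (3/4)))"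
    by (simp add: y_def x_def algebra_simps)
qed

theorem theorem1p3:
  "(\<lambda>n. real (min_max_load n)) \<sim>[at_top] (\<lambda>n. 2 ^ n / real n) \<and>
   (\<lambda>n. real n * real (min_max_load n) / 2 ^ n) \<longlonglongrightarrow> 1"
proof -
  have pos: "\<forall>\<^sub>F n in sequentially. real n - 2 * real n powr (3/4) > 0" by real_asymp
  have lim: "(\<lambda>n. real n * real (min_max_load n) / 2 ^ n) \<longlonglongrightarrow> 1"
  proof (rule tendsto_sandwich)
    show "\<forall>\<^sub>F n in sequentially. 1 - 1 / 2 ^ n \<le> real n * real (min_max_load n) / 2 ^ n"
      using pos eventually_ge_at_top[of 1]
    proof eventually_elim
      case (elim n)
      \<comment> \<open>The existence of some cover family ensures that the \<open>LEAST\<close> is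
        attained, so counting applies to an optimal family.\<close>
      then obtain \<G> where G: "cover_family n \<G>" "min_max_load n = max_load n \<G>"
        using scaled_load_upper(2) min_max_load_attained by metis
      have "real (2 ^ n) \<le> real (n * min_max_load n + 1)"
        using max_load_ge[OF G(1)] unfolding G(2) by (rule of_nat_mono)
      then have "(2 ^ n - 1) / 2 ^ n \<le> real n * real (min_max_load n) / 2 ^ n"
        by (intro divide_right_mono) auto
      then show ?case by (simp add: diff_divide_distrib)
    qed
    show "\<forall>\<^sub>F n in sequentially. real n * real (min_max_load n) / 2 ^ n \<le>
        real n / (real n - 2 * real n powr (3/4)) +
        4 * real n / (real n powr (3/4) * sqrt (real n - 2 * real n powr (3/4)))"
      using pos eventually_ge_at_top[of 1] by eventually_elim (rule scaled_load_upper)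
    show "(\<lambda>n. 1 - 1 / 2 ^ n :: real) \<longlonglongrightarrow> 1" by real_asymp
    show "(\<lambda>n. real n / (real n - 2 * real n powr (3/4)) +
        4 * real n / (real n powr (3/4) * sqrt (real n - 2 * real n powr (3/4)))) \<longlonglongrightarrow> 1"
      by real_asymp
  qed
  have "(\<lambda>n. real (min_max_load n)) \<sim>[at_top] (\<lambda>n. 2 ^ n / real n)"
  proof (rule asymp_equivI')
    show "(\<lambda>n. real (min_max_load n) / (2 ^ n / real n)) \<longlonglongrightarrow> 1"
      using lim by (simp add: mult.commute)
  qed
  then show ?thesis using lim by blast
qed

end
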